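(* Let $P$ be a finite poset of height $h(P)=r\ge 2$, let $t$ be an integer with $1\le t<r$, let $0<\alpha<1$ be fixed, and let $M_n=\binom{n}{\lfloor n/2\rfloor}$ (so $M_n=\Theta(2^n/\sqrt n)$). Assume that for every fixed $\gamma>0$ and every fixed $c>0$ one has $M_n^\gamma=\omega(n^c)$, and that for all sufficiently large $n$ there is a family $\mathcal{L}=\bigcup_{i=1}^{\lfloor M_n^\alpha\rfloor}C_i\subseteq B_n$ such that: each $C_i$ is an $(r-1)$-element chain; every element of $C_i$ is incomparable with every element of $C_j$ whenever $i\ne j$; $|\mathcal{C}_t(\mathcal{L})|=\lfloor M_n^\alpha\rfloor\binom{r-1}{t}$; $\max_{x\in\mathcal{L}}|\{C\in\mathcal{C}_t(\mathcal{L}):x\in C\}|=\binom{r-2}{t-1}$; and every subset of $\mathcal{L}$ is weakly $P$-free. Then for any integer-valued function $l(n)$ satisfying $2\le l(n)\le\lfloor M_n^\alpha\rfloor$ for all sufficiently large $n$: (1) If $l(n)=l\ge 2$ is fixed, then $\operatorname{RT}(\mathcal{B};n,P,l,t)\ge\binom{r-1}{t}(l-1)$ for all sufficiently large $n$. (2) If $l(n)\to\infty$ as $n\to\infty$, then $\operatorname{RT}(\mathcal{B};n,P,l(n),t)\ge(1-o(1))\binom{r-1}{t}\,l(n)$ for all sufficiently large $n$, where the $o(1)$ term tends to $0$ as $n\to\infty$. In particular: (3) For any fixed $c>0$, if $2\le l(n)\le\lfloor M_n^\alpha\rfloor$ for all sufficiently large $n$ and $l(n)=\omega(n^c)$, then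 $\operatorname{RT}(\mathcal{B};n,P,l(n),t)=\omega(n^c)$. (4) If $l(n)=\lfloor M_n^\beta\rfloor$ with $0<\beta\le\alpha$ fixed, then $\operatorname{RT}(\mathcal{B};n,P,l(n),t)=\Omega(2^{\beta n}n^{-\beta/2})$. Moreover, all the same lower bounds hold with $\operatorname{RT}$ replaced by the strong number $\operatorname{RT}^{\sharp}$, with the corresponding parameter $l$ or $l(n)$.
   Context: $B_n$ is the power set of $[n]=\{1,\dots,n\}$ ordered by inclusion; a subset $Q\subseteq B_n$ (possibly empty) is regarded as a poset with the induced order. A $t$-chain in a poset is a set of exactly $t$ distinct pairwise comparable elements, and $\mathcal{C}_t(Q)$ is the set of all $t$-chains of $Q$. The width $w(Q)$ is the size of a largest antichain of $Q$ and the height $h(P)$ is the size of a largest chain of $P$. An injection $f:P\to Q$ between posets is a weak embedding if $x\le y$ in $P$ implies $f(x)\le f(y)$ in $Q$, and a strong embedding if $x\le y$ in $P$ if and only if $f(x)\le f(y)$ in $Q$. $Q$ is weakly (resp. strongly) $P$-free if there is no weak (resp. strong) embedding of $P$ into $Q$. For positive integers $n,l,t$, $\operatorname{RT}(\mathcal{B};n,P,l,t)$ (resp. $\operatorname{RT}^{\sharp}(\mathcal{B};n,P,l,t)$) is the maximum of $|\mathcal{C}_t(Q)|$ over all $Q\subseteq B_n$ such that $Q$ is weakly (resp. strongly) $P$-free and $w(Q)<l$. Asymptotics are as $n\to\infty$: $a_n=\Omega(b_n)$ means $a_n\ge c\,b_n$ for some constant $c>0$ and all large $n$; $a_n=\omega(b_n)$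 means $a_n/b_n\to\infty$; $\Theta$ is as usual. *)

theory Defs
  imports Complex_Main "HOL-Library.Landau_Symbols"
begin

text \<open>A poset is a subset of a type of class \<^class>\<open>order\<close>, with the induced order. On
  sets of naturals this order is inclusion. All definitions taking a maximum are meant for
  finite posets.\<close>

definition Bool_lat :: "nat \<Rightarrow> nat set set" where
  "Bool_lat n = Pow {1..n}"

definition t_chains :: "nat \<Rightarrow> 'a::order set \<Rightarrow> 'a set set" where
  "t_chains t Q = {C. C \<subseteq> Q \<and> finite C \<and> card C = t \<and> Complete_Partial_Order.chain (\<le>) C}"

definition antichain :: "'a::order set \<Rightarrow> bool" where
  "antichain A \<longleftrightarrow> (\<forall>x\<in>A. \<forall>y\<in>A. x \<noteq> y \<longrightarrow> \<not> x \<le> y \<and> \<not> y \<le> x)"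

definition width :: "'a::order set \<Rightarrow> nat" where
  "width Q = Max {card A | A. A \<subseteq> Q \<and> antichain A}"

definition height :: "'a::order set \<Rightarrow> nat" where
  "height P = Max {card C | C. C \<subseteq> P \<and> Complete_Partial_Order.chain (\<le>) C}"

definition weak_embedding :: "('a::order \<Rightarrow> 'b::order) \<Rightarrow> 'a set \<Rightarrow> 'b set \<Rightarrow> bool" where
  "weak_embedding f P Q \<longleftrightarrow>
     f ` P \<subseteq> Q \<and> inj_on f P \<and> (\<forall>x\<in>P. \<forall>y\<in>P. x \<le> y \<longrightarrow> f x \<le> f y)"

definition strong_embedding :: "('a::order \<Rightarrow> 'b::order) \<Rightarrow> 'a set \<Rightarrow> 'b set \<Rightarrow> bool" where
  "strong_embedding f P Q \<longleftrightarrow>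
     f ` P \<subseteq> Q \<and> inj_on f P \<and> (\<forall>x\<in>P. \<forall>y\<in>P. x \<le> y \<longleftrightarrow> f x \<le> f y)"

definition weakly_free :: "'a::order set \<Rightarrow> 'b::order set \<Rightarrow> bool" where
  "weakly_free P Q \<longleftrightarrow> (\<nexists>f. weak_embedding f P Q)"

definition strongly_free :: "'a::order set \<Rightarrow> 'b::order set \<Rightarrow> bool" where
  "strongly_free P Q \<longleftrightarrow> (\<nexists>f. strong_embedding f P Q)"

text \<open>For nonempty \<open>P\<close> and \<open>l \<ge> 1\<close> the maxima below range over nonempty sets, because
  \<open>Q = {}\<close> is admissible.\<close>

definition RT :: "nat \<Rightarrow> 'a::order set \<Rightarrow> nat \<Rightarrow> nat \<Rightarrow> nat" where
  "RT n P l t = Max {card (t_chains t Q) | Q. Q \<subseteq> Bool_lat n \<and> weakly_free P Q \<and> width Q < l}"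

definition RT_sharp :: "nat \<Rightarrow> 'a::order set \<Rightarrow> nat \<Rightarrow> nat \<Rightarrow> nat" where
  "RT_sharp n P l t =
     Max {card (t_chains t Q) | Q. Q \<subseteq> Bool_lat n \<and> strongly_free P Q \<and> width Q < l}"

definition mid_binom :: "nat \<Rightarrow> nat" where
  "mid_binom n = n choose (n div 2)"

definition floor_pow :: "real \<Rightarrow> nat \<Rightarrow> nat" where
  "floor_pow \<beta> n = nat \<lfloor>real (mid_binom n) powr \<beta>\<rfloor>"

end

theory Submission
  imports Defs
begin

text \<open>The extremal family is built from the hypothesis: \<open>l - 1\<close> of the pairwise incomparable
  chains have a union of width at most \<open>l - 1\<close>, because an antichain meets each chain at most once.
  The union is \<open>P\<close>-free as a subset of the given family, and each chain contributes its own
  \<open>(r - 1) choose t\<close> chains of size \<open>t\<close>, since a nonempty set lies in at most one member of a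
  disjoint family. Hence both extremal numbers are at least \<open>((r - 1) choose t) * (l - 1)\<close> as soon
  as at least \<open>l - 1\<close> chains are available (\<open>extremal_numbers_ge\<close>); weak freeness implies strong
  freeness, so one family serves for both.

  All four asymptotic claims are readings of this one inequality. The binomial coefficient is
  positive, and \<open>l - 1\<close> equals \<open>(1 - 1 / l) * l\<close> and is at least \<open>l / 2\<close> for \<open>l \<ge> 2\<close>. The
  last claim also needs the true size of the middle binomial coefficient. It follows without
  Stirling's formula from the recurrence of the central binomial coefficients, which shows that
  \<open>((2 * m) choose m)\<^sup>2 / 16 ^ m\<close> lies between \<open>1 / (4 * m)\<close> and
  \<open>1 / (2 * m + 1)\<close> for \<open>m \<ge> 1\<close>.\<close>

section \<open>Size of the middle binomial coefficient\<close>

definition central_binom :: "nat \<Rightarrow> nat" where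
  "central_binom m = (2 * m) choose m"

lemma mid_binom_even: "mid_binom (2 * m) = central_binom m"
  by (simp add: mid_binom_def central_binom_def)

lemma choose_odd_middle: "(2 * m + 1) choose (m + 1) = (2 * m + 1) choose m"
  using binomial_symmetric[of m "2 * m + 1"] by simp

lemma mid_binom_odd: "2 * mid_binom (2 * m + 1) = central_binom (m + 1)"
proof -
  have "central_binom (m + 1) = ((2 * m + 1) choose m) + ((2 * m + 1) choose (m + 1))"
    by (simp add: central_binom_def)
  then show ?thesis by (simp only: choose_odd_middle mid_binom_def) simp
qed

lemma central_binom_Suc:
  "real (m + 1) * real (central_binom (m + 1)) = 2 * real (2 * m + 1) * real (central_binom m)"
proof -
  have "(m + 1) * ((2 * m + 1) choose (m + 1)) = (2 * m + 1) * central_binom m"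
    using Suc_times_binomial_eq[of "2 * m" m] by (simp add: central_binom_def algebra_simps)
  then have "(m + 1) * mid_binom (2 * m + 1) = (2 * m + 1) * central_binom m"
    by (simp only: choose_odd_middle mid_binom_def) simp
  then have "(m + 1) * central_binom (m + 1) = 2 * (2 * m + 1) * central_binom m"
    unfolding mid_binom_odd[symmetric] by (metis mult.assoc mult.left_commute)
  then have "real ((m + 1) * central_binom (m + 1)) = real (2 * (2 * m + 1) * central_binom m)"
    by (simp only:)
  then show ?thesis unfolding of_nat_mult by simp
qed

text \<open>Passing from \<open>m\<close> to \<open>m + 1\<close> multiplies the squared ratio of \<open>central_binom m\<close> to \<open>4 ^ m\<close>
  by \<open>((2 * m + 1) / (2 * m + 2))\<^sup>2\<close>. This factor is at most \<open>(2 * m + 1) / (2 * m + 3)\<close>, which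
  gives the upper bound.\<close>

lemma central_binom_sq_upper: "real (2 * m + 1) * (real (central_binom m))\<^sup>2 \<le> 16 ^ m"
proof (induction m)
  case (Suc m)
  define a where "a = real (central_binom m)"
  define b where "b = real (central_binom (m + 1))"
  have rec: "(real m + 1) * b = 2 * (2 * real m + 1) * a"
    using central_binom_Suc[of m] by (simp add: a_def b_def algebra_simps)
  have "(real m + 1)\<^sup>2 * ((2 * real m + 3) * b\<^sup>2) = (2 * real m + 3) * ((real m + 1) * b)\<^sup>2"
    by (simp add: power_mult_distrib)
  also have "\<dots> = 4 * (2 * real m + 3) * (2 * real m + 1) * ((2 * real m + 1) * a\<^sup>2)"
    unfolding rec by (simp add: power2_eq_square algebra_simps)
  also have "\<dots> \<le> 4 * (2 * real m + 3) * (2 * real m + 1) * 16 ^ m"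
    using Suc by (intro mult_left_mono) (simp_all add: a_def add.commute)
  also have "\<dots> \<le> (16 * (real m + 1)\<^sup>2) * 16 ^ m"
    by (intro mult_right_mono) (simp_all add: power2_eq_square algebra_simps)
  finally have "(real m + 1)\<^sup>2 * ((2 * real m + 3) * b\<^sup>2) \<le> (real m + 1)\<^sup>2 * (16 * 16 ^ m)"
    by (simp add: mult_ac)
  then have "(2 * real m + 3) * b\<^sup>2 \<le> 16 * 16 ^ m"
    by (rule mult_left_le_imp_le) simp
  then show ?case by (simp add: b_def algebra_simps)
qed (simp add: central_binom_def)

text \<open>The same factor is at least \<open>m / (m + 1)\<close>, which gives the lower bound.\<close>

lemma central_binom_sq_lower:
  "m \<ge> 1 \<Longrightarrow> 16 ^ m \<le> 4 * real m * (real (central_binom m))\<^sup>2"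
proof (induction m rule: nat_induct_at_least)
  case (Suc m)
  define a where "a = real (central_binom m)"
  define b where "b = real (central_binom (m + 1))"
  have rec: "(real m + 1) * b = 2 * (2 * real m + 1) * a"
    using central_binom_Suc[of m] by (simp add: a_def b_def algebra_simps)
  have "(real m + 1) * 16 ^ (m + 1) = 16 * (real m + 1) * 16 ^ m"
    by simp
  also have "\<dots> \<le> 16 * (real m + 1) * (4 * real m * a\<^sup>2)"
    using Suc by (intro mult_left_mono) (simp_all add: a_def)
  also have "\<dots> = (64 * (real m + 1) * real m) * a\<^sup>2"
    by simp
  also have "\<dots> \<le> (16 * (2 * real m + 1)\<^sup>2) * a\<^sup>2"
    by (intro mult_right_mono) (simp_all add: power2_eq_square algebra_simps)
  also have "\<dots> = 4 * ((real m + 1) * b)\<^sup>2"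
    unfolding rec by (simp add: power2_eq_square algebra_simps)
  also have "\<dots> = (real m + 1) * (4 * (real m + 1) * b\<^sup>2)"
    by (simp add: power2_eq_square)
  finally have "16 ^ (m + 1) \<le> 4 * (real m + 1) * b\<^sup>2"
    by (rule mult_left_le_imp_le) simp
  then show ?case by (simp add: b_def algebra_simps)
qed (simp add: central_binom_def)

text \<open>For odd \<open>n\<close> the middle coefficient is half of the next central one, so both parities
  reduce to the two bounds on central coefficients.\<close>

lemma mid_binom_sq_bounds:
  assumes "n \<ge> 1"
  shows "real n * (real (mid_binom n))\<^sup>2 \<le> 4 ^ n \<and> 4 ^ n \<le> 4 * (real n * (real (mid_binom n))\<^sup>2)"
proof (cases "even n")
  case True
  then obtain m where n: "n = 2 * m" by blast
  define c where "c = real (mid_binom n)"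
  have c: "real (central_binom m) = c"
    by (simp add: c_def n mid_binom_even)
  have pow: "(16::real) ^ m = 4 ^ n" by (simp add: n power_mult)
  have "real n * c\<^sup>2 \<le> real (2 * m + 1) * c\<^sup>2"
    unfolding n by (intro mult_right_mono) simp_all
  also have "\<dots> \<le> 4 ^ n"
    using central_binom_sq_upper[of m] by (simp add: pow c)
  finally have up: "real n * c\<^sup>2 \<le> 4 ^ n" .
  have "4 ^ n \<le> 4 * real m * c\<^sup>2"
    using central_binom_sq_lower[of m] assms by (simp add: pow c n)
  also have "\<dots> \<le> 4 * real n * c\<^sup>2"
    by (intro mult_right_mono) (simp_all add: n)
  finally show ?thesis using up by (simp add: c_def)
next
  case False
  then obtain m where n: "n = 2 * m + 1" by (rule oddE)
  define c where "c = real (mid_binom n)"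
  have c: "real (central_binom (m + 1)) = 2 * c"
    unfolding c_def n mid_binom_odd[symmetric] by simp
  have pow: "(16::real) ^ (m + 1) = 4 * 4 ^ n" by (simp add: n power_mult)
  have "real (2 * (m + 1) + 1) * (2 * c)\<^sup>2 \<le> 4 * 4 ^ n"
    using central_binom_sq_upper[of "m + 1"] unfolding pow c .
  then have "real (2 * (m + 1) + 1) * c\<^sup>2 \<le> 4 ^ n"
    by (simp only: power_mult_distrib) simp
  moreover have "real n * c\<^sup>2 \<le> real (2 * (m + 1) + 1) * c\<^sup>2"
    by (intro mult_right_mono) (simp_all add: n)
  ultimately have up: "real n * c\<^sup>2 \<le> 4 ^ n" by linarith
  have "4 * 4 ^ n \<le> 4 * real (m + 1) * (2 * c)\<^sup>2"
    using central_binom_sq_lower[of "m + 1"] unfolding pow c by simp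
  then have "4 ^ n \<le> (4 * real (m + 1)) * c\<^sup>2" by (simp only: power_mult_distrib) simp
  also have "\<dots> \<le> (4 * real n) * c\<^sup>2"
    by (intro mult_right_mono) (simp_all add: n)
  finally show ?thesis using up by (simp add: c_def)
qed

lemma mid_binom_bounds:
  assumes "n \<ge> 1"
  shows "real (mid_binom n) \<le> 2 ^ n / sqrt n" and "2 ^ n / sqrt n \<le> 2 * real (mid_binom n)"
proof -
  have pow: "((2::real) ^ n)\<^sup>2 = 4 ^ n" by (simp flip: power_mult_distrib add: power2_eq_square)
  have "(sqrt n * real (mid_binom n))\<^sup>2 \<le> (2 ^ n)\<^sup>2"
    using mid_binom_sq_bounds[OF assms] by (simp add: pow power_mult_distrib)
  then have "sqrt n * real (mid_binom n) \<le> 2 ^ n"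
    by (rule power2_le_imp_le) simp
  then show "real (mid_binom n) \<le> 2 ^ n / sqrt n"
    using assms by (simp add: field_simps)
  have "(2 ^ n)\<^sup>2 \<le> (2 * (sqrt n * real (mid_binom n)))\<^sup>2"
    using mid_binom_sq_bounds[OF assms] by (simp add: pow power_mult_distrib)
  then have "2 ^ n \<le> 2 * (sqrt n * real (mid_binom n))"
    by (rule power2_le_imp_le) simp
  then show "2 ^ n / sqrt n \<le> 2 * real (mid_binom n)"
    using assms by (simp add: field_simps)
qed

lemma mid_binom_bigtheta: "(\<lambda>n. real (mid_binom n)) \<in> \<Theta>(\<lambda>n. 2 ^ n / sqrt (real n))"
proof (rule bigthetaI')
  show "\<forall>\<^sub>F n in sequentially.
      1 / 2 * norm (2 ^ n / sqrt (real n)) \<le> norm (real (mid_binom n)) \<and>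
      norm (real (mid_binom n)) \<le> 1 * norm (2 ^ n / sqrt (real n))"
    using eventually_ge_at_top[of 1] by eventually_elim (use mid_binom_bounds in force)
qed simp_all

section \<open>Unions of disjoint chains\<close>

text \<open>Two elements of one chain are comparable, so sending each element of an antichain to the
  index of a chain that contains it is injective.\<close>

lemma width_UN_chains_le:
  assumes "finite I" and "\<And>i. i \<in> I \<Longrightarrow> finite (C i)"
    and chain: "\<And>i. i \<in> I \<Longrightarrow> Complete_Partial_Order.chain (\<le>) (C i)"
  shows "width (\<Union>i\<in>I. C i) \<le> card I"
proof -
  let ?U = "\<Union>i\<in>I. C i"
  have "finite ?U" using assms by blast
  have "card A \<le> card I" if A: "A \<subseteq> ?U" "antichain A" for A
  proof -
    from A(1) obtain g where g: "\<And>x. x \<in> A \<Longrightarrow> g x \<in> I \<and> x \<in> C (g x)"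
      by (metis UN_E subsetD)
    have "inj_on g A"
    proof (rule inj_onI)
      fix x y assume xy: "x \<in> A" "y \<in> A" "g x = g y"
      then have "x \<le> y \<or> y \<le> x"
        using g[of x] g[of y] chain[of "g x"] by (auto simp: Complete_Partial_Order.chain_def)
      then show "x = y" using A(2) xy by (auto simp: antichain_def)
    qed
    then show ?thesis using g \<open>finite I\<close> by (intro card_inj_on_le[of g]) auto
  qed
  moreover have "finite {card A |A. A \<subseteq> ?U \<and> antichain A}"
    by (rule finite_subset[of _ "card ` Pow ?U"]) (use \<open>finite ?U\<close> in auto)
  moreover have "{card A |A. A \<subseteq> ?U \<and> antichain A} \<noteq> {}"
    by (auto simp: antichain_def intro!: exI[of _ "{}"])
  ultimately show ?thesis unfolding width_def by (intro Max.boundedI) auto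
qed

lemma finite_t_chains: "finite Q \<Longrightarrow> finite (t_chains t Q)"
  by (rule finite_subset[of _ "Pow Q"]) (auto simp: t_chains_def)

text \<open>For \<open>t \<ge> 1\<close> a \<open>t\<close>-element set lies in at most one of the disjoint chains, so the
  \<open>t\<close>-subsets of the different chains add up. For \<open>t = 0\<close> the empty chain would be shared by all
  of them.\<close>

lemma card_t_chains_UN_ge:
  assumes "finite I" and "t \<ge> 1"
    and C: "\<And>i. i \<in> I \<Longrightarrow> finite (C i) \<and> card (C i) = s \<and> Complete_Partial_Order.chain (\<le>) (C i)"
    and disj: "\<And>i j. i \<in> I \<Longrightarrow> j \<in> I \<Longrightarrow> i \<noteq> j \<Longrightarrow> C i \<inter> C j = {}"
  shows "card I * (s choose t) \<le> card (t_chains t (\<Union>i\<in>I. C i))"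
proof -
  let ?D = "\<lambda>i. {D. D \<subseteq> C i \<and> card D = t}"
  have "card (\<Union>i\<in>I. ?D i) = (\<Sum>i\<in>I. card (?D i))"
  proof (rule card_UN_disjoint[OF \<open>finite I\<close>])
    show "\<forall>i\<in>I. finite (?D i)" using C by simp
    show "\<forall>i\<in>I. \<forall>j\<in>I. i \<noteq> j \<longrightarrow> ?D i \<inter> ?D j = {}"
    proof (intro ballI impI equals0I)
      fix i j D assume "i \<in> I" "j \<in> I" "i \<noteq> j" and D: "D \<in> ?D i \<inter> ?D j"
      then have "D \<subseteq> {}" using disj by blast
      with D \<open>t \<ge> 1\<close> show False by auto
    qed
  qed
  also have "\<dots> = card I * (s choose t)"
    using C by (simp add: n_subsets)
  finally have "card I * (s choose t) = card (\<Union>i\<in>I. ?D i)" by simp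
  also have "\<dots> \<le> card (t_chains t (\<Union>i\<in>I. C i))"
  proof (rule card_mono)
    show "finite (t_chains t (\<Union>i\<in>I. C i))"
      using assms by (intro finite_t_chains) blast
    show "(\<Union>i\<in>I. ?D i) \<subseteq> t_chains t (\<Union>i\<in>I. C i)"
    proof
      fix D assume "D \<in> (\<Union>i\<in>I. ?D i)"
      then obtain i where i: "i \<in> I" "D \<subseteq> C i" "card D = t" by blast
      then have "finite D" "Complete_Partial_Order.chain (\<le>) D"
        using C[OF i(1)] finite_subset[of D "C i"]
          Complete_Partial_Order.chain_subset[of "(\<le>)" "C i" D]
        by simp_all
      with i show "D \<in> t_chains t (\<Union>i\<in>I. C i)" by (auto simp: t_chains_def)
    qed
  qed
  finally show ?thesis .
qed

section \<open>A lower bound for both extremal numbers\<close>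

lemma weakly_free_imp_strongly_free: "weakly_free P Q \<Longrightarrow> strongly_free P Q"
  unfolding weakly_free_def strongly_free_def weak_embedding_def strong_embedding_def by meson

lemma card_t_chains_le_extremal_number:
  assumes "R \<in> {RT, RT_sharp}"
    and Q: "Q \<subseteq> Bool_lat n" "weakly_free P Q" "width Q < l"
  shows "card (t_chains t Q) \<le> R n P l t"
proof -
  have fin: "finite {card (t_chains t Q) |Q. Q \<subseteq> Bool_lat n \<and> F Q}" for F
    by (rule finite_subset[of _ "(\<lambda>Q. card (t_chains t Q)) ` Pow (Bool_lat n)"])
      (auto simp: Bool_lat_def)
  have "card (t_chains t Q) \<le> RT n P l t"
    unfolding RT_def using Q by (intro Max_ge fin) blast
  moreover have "card (t_chains t Q) \<le> RT_sharp n P l t"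
    unfolding RT_sharp_def using Q weakly_free_imp_strongly_free by (intro Max_ge fin) blast
  ultimately show ?thesis using assms(1) by auto
qed

lemma extremal_numbers_ge:
  fixes C :: "nat \<Rightarrow> nat set set"
  assumes R: "R \<in> {RT, RT_sharp}" and "t \<ge> 1" and "l \<ge> 1" and "l - 1 \<le> m"
    and L: "(\<Union>i\<in>{1..m}. C i) \<subseteq> Bool_lat n"
    and free: "weakly_free P (\<Union>i\<in>{1..l - 1}. C i)"
    and C: "\<And>i. i \<in> {1..m} \<Longrightarrow> C i \<in> t_chains s (\<Union>i\<in>{1..m}. C i)"
    and inc: "\<And>i j x y. i \<in> {1..m} \<Longrightarrow> j \<in> {1..m} \<Longrightarrow> i \<noteq> j \<Longrightarrow> x \<in> C i \<Longrightarrow> y \<in> C j \<Longrightarrow> \<not> x \<subseteq> y"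
  shows "(s choose t) * (l - 1) \<le> R n P l t"
proof -
  let ?Q = "\<Union>i\<in>{1..l - 1}. C i"
  have chains: "finite (C i) \<and> card (C i) = s \<and> Complete_Partial_Order.chain (\<le>) (C i)"
    if "i \<in> {1..l - 1}" for i
    using C[of i] that \<open>l - 1 \<le> m\<close> by (auto simp: t_chains_def)
  have "width ?Q \<le> card {1..l - 1}"
    using chains by (intro width_UN_chains_le) auto
  then have "width ?Q < l" using \<open>l \<ge> 1\<close> by simp
  moreover have "?Q \<subseteq> Bool_lat n" using L \<open>l - 1 \<le> m\<close> by fastforce
  ultimately have "card (t_chains t ?Q) \<le> R n P l t"
    using R free by (intro card_t_chains_le_extremal_number)
  moreover have "C i \<inter> C j = {}" if "i \<in> {1..l - 1}" "j \<in> {1..l - 1}" "i \<noteq> j" for i j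
    using inc[of i j] that \<open>l - 1 \<le> m\<close> by fastforce
  then have "card {1..l - 1} * (s choose t) \<le> card (t_chains t ?Q)"
    using \<open>t \<ge> 1\<close> chains by (intro card_t_chains_UN_ge) auto
  ultimately show ?thesis by (simp add: mult.commute)
qed

section \<open>Asymptotic consequences\<close>

lemma floor_pow_mono:
  assumes "\<beta> \<le> \<alpha>"
  shows "floor_pow \<beta> n \<le> floor_pow \<alpha> n"
proof -
  have "mid_binom n \<ge> 1" by (simp add: mid_binom_def Suc_leI)
  then have "real (mid_binom n) powr \<beta> \<le> real (mid_binom n) powr \<alpha>"
    using assms by (intro powr_mono) auto
  then show ?thesis unfolding floor_pow_def by (intro nat_mono floor_mono)
qed

lemma floor_pow_gt: "real (mid_binom n) powr \<beta> - 1 < real (floor_pow \<beta> n)"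
  unfolding floor_pow_def by linarith

theorem theorem1p3:
  fixes P :: "'p::order set" and r t :: nat and \<alpha> :: real
  assumes "finite P" and "height P = r" and "r \<ge> 2"
    and "1 \<le> t" and "t < r"
    and "0 < \<alpha>" and "\<alpha> < 1"
    and "\<And>\<gamma> c :: real. \<gamma> > 0 \<Longrightarrow> c > 0 \<Longrightarrow>
           (\<lambda>n. real (mid_binom n) powr \<gamma>) \<in> \<omega>(\<lambda>n. real n powr c)"
    and "\<forall>\<^sub>F n in sequentially. \<exists>(C :: nat \<Rightarrow> nat set set) L.
           L = (\<Union>i\<in>{1..floor_pow \<alpha> n}. C i) \<and>
           L \<subseteq> Bool_lat n \<and>
           (\<forall>i\<in>{1..floor_pow \<alpha> n}. C i \<in> t_chains (r - 1) L) \<and>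
           (\<forall>i\<in>{1..floor_pow \<alpha> n}. \<forall>j\<in>{1..floor_pow \<alpha> n}. i \<noteq> j \<longrightarrow>
              (\<forall>x\<in>C i. \<forall>y\<in>C j. \<not> x \<subseteq> y \<and> \<not> y \<subseteq> x)) \<and>
           card (t_chains t L) = floor_pow \<alpha> n * ((r - 1) choose t) \<and>
           Max {card {D \<in> t_chains t L. x \<in> D} | x. x \<in> L} = ((r - 2) choose (t - 1)) \<and>
           (\<forall>Q\<subseteq>L. weakly_free P Q)"
  shows "(\<lambda>n. real (mid_binom n)) \<in> \<Theta>(\<lambda>n. 2 ^ n / sqrt (real n)) \<and>
    (\<forall>R \<in> {RT, RT_sharp}.
      (\<forall>l::nat. l \<ge> 2 \<longrightarrow>
         (\<forall>\<^sub>F n in sequentially. R n P l t \<ge> ((r - 1) choose t) * (l - 1))) \<and>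
      (\<forall>l :: nat \<Rightarrow> nat.
         (\<forall>\<^sub>F n in sequentially. 2 \<le> l n \<and> l n \<le> floor_pow \<alpha> n) \<longrightarrow>
         filterlim l at_top sequentially \<longrightarrow>
         (\<exists>\<epsilon> :: nat \<Rightarrow> real. \<epsilon> \<longlonglongrightarrow> 0 \<and>
            (\<forall>\<^sub>F n in sequentially.
               real (R n P (l n) t) \<ge> (1 - \<epsilon> n) * real ((r - 1) choose t) * real (l n)))) \<and>
      (\<forall>(c::real) (l :: nat \<Rightarrow> nat). c > 0 \<longrightarrow>
         (\<forall>\<^sub>F n in sequentially. 2 \<le> l n \<and> l n \<le> floor_pow \<alpha> n) \<longrightarrow>
         (\<lambda>n. real (l n)) \<in> \<omega>(\<lambda>n. real n powr c) \<longrightarrow>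
         (\<lambda>n. real (R n P (l n) t)) \<in> \<omega>(\<lambda>n. real n powr c)) \<and>
      (\<forall>\<beta>::real. 0 < \<beta> \<longrightarrow> \<beta> \<le> \<alpha> \<longrightarrow>
         (\<lambda>n. real (R n P (floor_pow \<beta> n) t))
           \<in> \<Omega>(\<lambda>n. 2 powr (\<beta> * real n) * real n powr (- \<beta> / 2))))"
proof -
  define B where "B = (r - 1) choose t"
  have "B \<ge> 1" using assms(5) by (simp add: B_def Suc_leI)

  have key: "\<forall>\<^sub>F n in sequentially. \<forall>R \<in> {RT, RT_sharp}. \<forall>l \<ge> 1.
      l - 1 \<le> floor_pow \<alpha> n \<longrightarrow> B * (l - 1) \<le> R n P l t"
    using assms(9)
  proof eventually_elim
    case (elim n)
    let ?m = "floor_pow \<alpha> n"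
    from elim obtain C :: "nat \<Rightarrow> nat set set" and L where union: "L = (\<Union>i\<in>{1..?m}. C i)" and
      L: "L \<subseteq> Bool_lat n" and
      C: "\<forall>i\<in>{1..?m}. C i \<in> t_chains (r - 1) L" and
      inc: "\<forall>i\<in>{1..?m}. \<forall>j\<in>{1..?m}. i \<noteq> j \<longrightarrow> (\<forall>x\<in>C i. \<forall>y\<in>C j. \<not> x \<subseteq> y \<and> \<not> y \<subseteq> x)" and
      free: "\<forall>Q\<subseteq>L. weakly_free P Q"
      by (elim exE conjE) rule
    show ?case
    proof (intro ballI allI impI)
      fix R :: "nat \<Rightarrow> 'p set \<Rightarrow> nat \<Rightarrow> nat \<Rightarrow> nat" and l :: nat
      assume R: "R \<in> {RT, RT_sharp}" and l: "1 \<le> l" "l - 1 \<le> ?m"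
      have "(\<Union>i\<in>{1..l - 1}. C i) \<subseteq> L"
        unfolding union using l by (intro UN_mono) auto
      with free have "weakly_free P (\<Union>i\<in>{1..l - 1}. C i)" by blast
      then show "B * (l - 1) \<le> R n P l t"
        unfolding B_def using C inc
        by (intro extremal_numbers_ge[OF R assms(4) l L[unfolded union]]) (simp_all add: union)
    qed
  qed

  have powr_top: "filterlim (\<lambda>n. real (mid_binom n) powr \<beta>) at_top sequentially"
    if "\<beta> > 0" for \<beta>
  proof (rule filterlim_at_top_mono[OF filterlim_real_sequentially])
    show "\<forall>\<^sub>F n in sequentially. real n \<le> real (mid_binom n) powr \<beta>"
      using landau_omega.smallD[OF assms(8)[OF that zero_less_one], of 1] by simp
  qed
  have floor_ge: "\<forall>\<^sub>F n in sequentially. k \<le> floor_pow \<beta> n" if "\<beta> > 0" for \<beta> k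
  proof -
    have "\<forall>\<^sub>F n in sequentially. real k + 1 \<le> real (mid_binom n) powr \<beta>"
      using powr_top[OF that] by (simp add: filterlim_at_top)
    then show ?thesis
    proof eventually_elim
      case (elim n)
      with floor_pow_gt[of n \<beta>] show ?case by linarith
    qed
  qed

  have fixed: "\<forall>\<^sub>F n in sequentially. R n P l t \<ge> B * (l - 1)"
    if "R \<in> {RT, RT_sharp}" "l \<ge> 2" for R and l :: nat
    using key floor_ge[OF assms(6), of "l - 1"]
    by eventually_elim (use that in auto)

  have varying: "\<forall>\<^sub>F n in sequentially. l n \<ge> 2 \<and>
      real (R n P (l n) t) \<ge> (1 - 1 / real (l n)) * real B * real (l n)"
    if "R \<in> {RT, RT_sharp}"
      and l: "\<forall>\<^sub>F n in sequentially. 2 \<le> l n \<and> l n \<le> floor_pow \<alpha> n" for R l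
    using key l
  proof eventually_elim
    case (elim n)
    then have "B * (l n - 1) \<le> R n P (l n) t" using that(1) by auto
    then have "real (B * (l n - 1)) \<le> real (R n P (l n) t)" by (simp only: of_nat_le_iff)
    also have "real (B * (l n - 1)) = (1 - 1 / real (l n)) * real B * real (l n)"
      using elim by (simp add: of_nat_diff field_simps)
    finally show ?case using elim by blast
  qed

  have half: "\<forall>\<^sub>F n in sequentially. real (l n) / 2 \<le> real (R n P (l n) t)"
    if R: "R \<in> {RT, RT_sharp}"
      and l: "\<forall>\<^sub>F n in sequentially. 2 \<le> l n \<and> l n \<le> floor_pow \<alpha> n" for R l
    using varying[OF R l]
  proof eventually_elim
    case (elim n)
    have "real (l n) / 2 \<le> real (l n) - 1" using elim by simp
    also have "\<dots> \<le> real B * (real (l n) - 1)"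
      using \<open>B \<ge> 1\<close> elim by (intro mult_le_cancel_right1[THEN iffD2]) auto
    also have "\<dots> = (1 - 1 / real (l n)) * real B * real (l n)"
      using elim by (simp add: field_simps)
    finally show ?case using elim by linarith
  qed

  have relative: "\<exists>\<epsilon> :: nat \<Rightarrow> real. \<epsilon> \<longlonglongrightarrow> 0 \<and> (\<forall>\<^sub>F n in sequentially.
      real (R n P (l n) t) \<ge> (1 - \<epsilon> n) * real B * real (l n))"
    if R: "R \<in> {RT, RT_sharp}"
      and l: "\<forall>\<^sub>F n in sequentially. 2 \<le> l n \<and> l n \<le> floor_pow \<alpha> n"
      and "filterlim l at_top sequentially" for R l
  proof (intro exI conjI)
    have "filterlim (\<lambda>n. real (l n)) at_top sequentially"
      by (rule filterlim_compose[OF filterlim_real_sequentially that(3)])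
    then show "(\<lambda>n. 1 / real (l n)) \<longlonglongrightarrow> 0"
      by (intro tendsto_divide_0[OF tendsto_const] filterlim_at_top_imp_at_infinity)
    show "\<forall>\<^sub>F n in sequentially. real (R n P (l n) t) \<ge> (1 - 1 / real (l n)) * real B * real (l n)"
      using varying[OF R l] by eventually_elim simp
  qed

  have superpoly: "(\<lambda>n. real (R n P (l n) t)) \<in> \<omega>(\<lambda>n. real n powr c)"
    if R: "R \<in> {RT, RT_sharp}"
      and l: "\<forall>\<^sub>F n in sequentially. 2 \<le> l n \<and> l n \<le> floor_pow \<alpha> n"
      and om: "(\<lambda>n. real (l n)) \<in> \<omega>(\<lambda>n. real n powr c)" for R l and c :: real
  proof (rule landau_omega.big_small_trans[OF _ om])
    show "(\<lambda>n. real (R n P (l n) t)) \<in> \<Omega>(\<lambda>n. real (l n))"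
    proof (rule landau_omega.bigI[of "1 / 2"])
      show "\<forall>\<^sub>F n in sequentially. norm (real (R n P (l n) t)) \<ge> 1 / 2 * norm (real (l n))"
        using half[OF R l] by eventually_elim simp
    qed simp
  qed

  have power: "(\<lambda>n. real (R n P (floor_pow \<beta> n) t))
      \<in> \<Omega>(\<lambda>n. 2 powr (\<beta> * real n) * real n powr (- \<beta> / 2))"
    if R: "R \<in> {RT, RT_sharp}" and \<beta>: "0 < \<beta>" "\<beta> \<le> \<alpha>" for R \<beta>
  proof (rule landau_omega.bigI)
    \<comment> \<open>One factor \<open>1 / 2\<close> is lost from \<open>l\<close> to \<open>l - 1\<close>, one from rounding, and \<open>2 powr - \<beta>\<close>
      in the estimate of the middle binomial coefficient.\<close>
    let ?c = "1 / 4 * 2 powr (- \<beta>) :: real"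
    have l: "\<forall>\<^sub>F n in sequentially. 2 \<le> floor_pow \<beta> n \<and> floor_pow \<beta> n \<le> floor_pow \<alpha> n"
      using floor_ge[OF \<beta>(1), of 2] by eventually_elim (simp add: floor_pow_mono[OF \<beta>(2)])
    show "\<forall>\<^sub>F n in sequentially. norm (real (R n P (floor_pow \<beta> n) t))
        \<ge> ?c * norm (2 powr (\<beta> * real n) * real n powr (- \<beta> / 2))"
      using half[OF R l] l eventually_ge_at_top[of 1]
    proof eventually_elim
      case (elim n)
      have n: "real n > 0" using elim by simp
      have "2 powr (\<beta> * real n) * real n powr (- \<beta> / 2) = (2 ^ n / sqrt (real n)) powr \<beta>"
        using n by (simp add: powr_divide powr_powr powr_minus_divide mult.commute
            flip: powr_half_sqrt powr_realpow)
      also have "\<dots> \<le> (2 * real (mid_binom n)) powr \<beta>"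
        using mid_binom_bounds(2)[of n] elim \<beta> by (intro powr_mono2) auto
      also have "\<dots> = 2 powr \<beta> * real (mid_binom n) powr \<beta>" by (simp add: powr_mult)
      finally have "2 powr (- \<beta>) * (2 powr (\<beta> * real n) * real n powr (- \<beta> / 2))
          \<le> 2 powr (- \<beta>) * (2 powr \<beta> * real (mid_binom n) powr \<beta>)"
        by (rule mult_left_mono) simp
      also have "\<dots> = real (mid_binom n) powr \<beta>"
        by (simp flip: mult.assoc powr_add)
      also have "\<dots> \<le> 2 * real (floor_pow \<beta> n)"
        using floor_pow_gt[of n \<beta>] elim by linarith
      also have "\<dots> \<le> 4 * real (R n P (floor_pow \<beta> n) t)"
        using elim by linarith
      finally show ?case by simp
    qed
  qed simp

  show ?thesis
    unfolding B_def[symmetric]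
  proof (rule conjI[OF mid_binom_bigtheta], rule ballI)
    fix R :: "nat \<Rightarrow> 'p set \<Rightarrow> nat \<Rightarrow> nat \<Rightarrow> nat"
    assume R: "R \<in> {RT, RT_sharp}"
    show "(\<forall>l\<ge>2. \<forall>\<^sub>F n in sequentially. R n P l t \<ge> B * (l - 1)) \<and>
      (\<forall>l. (\<forall>\<^sub>F n in sequentially. 2 \<le> l n \<and> l n \<le> floor_pow \<alpha> n) \<longrightarrow>
        filterlim l at_top sequentially \<longrightarrow>
        (\<exists>\<epsilon> :: nat \<Rightarrow> real. \<epsilon> \<longlonglongrightarrow> 0 \<and> (\<forall>\<^sub>F n in sequentially.
          real (R n P (l n) t) \<ge> (1 - \<epsilon> n) * real B * real (l n)))) \<and>
      (\<forall>(c::real) l. c > 0 \<longrightarrow>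
        (\<forall>\<^sub>F n in sequentially. 2 \<le> l n \<and> l n \<le> floor_pow \<alpha> n) \<longrightarrow>
        (\<lambda>n. real (l n)) \<in> \<omega>(\<lambda>n. real n powr c) \<longrightarrow>
        (\<lambda>n. real (R n P (l n) t)) \<in> \<omega>(\<lambda>n. real n powr c)) \<and>
      (\<forall>\<beta>>0. \<beta> \<le> \<alpha> \<longrightarrow> (\<lambda>n. real (R n P (floor_pow \<beta> n) t))
        \<in> \<Omega>(\<lambda>n. 2 powr (\<beta> * real n) * real n powr (- \<beta> / 2)))"
      using fixed[OF R] relative[OF R] superpoly[OF R] power[OF R]
      by (intro conjI allI impI) assumption+
  qed
qed

end
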